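(* Let $q\in\mathbb{N}$ and $\mathbf{c}=(c_1,\dots,c_q)\in\mathbb{N}^q$. Let $\Sigma=\{\zeta_{\mathbf{i}},\tau_j\mid\mathbf{i}\in[\mathbf{c}],\ j\in[q]\}$ be an alphabet with $q+\prod_{j=1}^q c_j$ letters, and let $\mathcal{L}\subset\Sigma^*$ be the set of words satisfying the following two conditions: (1) every substring $\tau_i\tau_j$ has $i\le j$; (2) for each $j\in[q]$: in every substring with no $\tau_j$, if $\zeta_{\mathbf{i}}$ occurs to the left of some $\zeta_{\mathbf{i}'}$, then the $j$-th entry of $\mathbf{i}$ is less than or equal to the $j$-th entry of $\mathbf{i}'$. Then the language $\mathcal{L}$ is recognized by a finite automaton.
   Context: $\mathbb{N}$ denotes the positive integers, $[n]=\{1,\dots,n\}$ and $[\mathbf{c}]=[c_1]\times\cdots\times[c_q]$. $\Sigma^*$ is the free monoid on $\Sigma$ (all finite words, including the empty word). A substring of a word is a string of consecutive letters of it. A (deterministic) finite automaton on $\Sigma$ is a $5$-tuple $(P,\Sigma,\delta,p_0,F)$ consisting of a finite set $P$ of states, an initial state $p_0\in P$, a set $F\subset P$ of accepting states, and a transition map $\delta\colon D\to P$, where $D\subset P\times\Sigma$. It accepts a word $a_1a_2\cdots a_s\in\Sigma^*$ if there are states $r_0,\dots,r_s$ with $r_0=p_0$, $r_s\in F$ and $r_{j+1}=\delta(r_j,a_{j+1})$ (in particular $(r_j,a_{j+1})\in D$) for $0\le j<s$. It recognizes a language $\mathcal{L}\subset\Sigma^*$ if $\mathcal{L}$ is precisely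 the set of words it accepts. *)

theory Defs
  imports Main "HOL-Library.FuncSet" "HOL-Library.Sublist"
begin

record ('p, 'a) automaton =
  states :: "'p set"
  alphabet :: "'a set"
  trans :: "'p \<times> 'a \<rightharpoonup> 'p"
  init :: 'p
  accepting :: "'p set"

text \<open>The domain of the partial map \<open>trans A\<close> is the set \<open>D\<close> in \<open>\<delta> : D \<rightarrow> P\<close>.\<close>

definition finite_automaton :: "('p, 'a) automaton \<Rightarrow> bool" where
  "finite_automaton A \<longleftrightarrow>
     finite (states A) \<and>
     init A \<in> states A \<and>
     accepting A \<subseteq> states A \<and>
     dom (trans A) \<subseteq> states A \<times> alphabet A \<and>
     ran (trans A) \<subseteq> states A"

definition accepts :: "('p, 'a) automaton \<Rightarrow> 'a list \<Rightarrow> bool" where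
  "accepts A w \<longleftrightarrow>
     (\<exists>r :: nat \<Rightarrow> 'p.
        (\<forall>j \<le> length w. r j \<in> states A) \<and>
        r 0 = init A \<and>
        r (length w) \<in> accepting A \<and>
        (\<forall>j < length w. trans A (r j, w ! j) = Some (r (Suc j))))"

definition recognizes :: "('p, 'a) automaton \<Rightarrow> 'a list set \<Rightarrow> bool" where
  "recognizes A L \<longleftrightarrow> L = {w \<in> lists (alphabet A). accepts A w}"

text \<open>Existence of an automaton is stated with states in \<open>nat\<close>. Since the set of states is
  finite, it can always be renamed into \<open>nat\<close>, so this is no restriction.\<close>

definition recognized_by_finite_automaton :: "'a set \<Rightarrow> 'a list set \<Rightarrow> bool" where
  "recognized_by_finite_automaton S L \<longleftrightarrow>
     (\<exists>A :: (nat, 'a) automaton. finite_automaton A \<and> alphabet A = S \<and> recognizes A L)"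

text \<open>A tuple indexed by \<open>[q]\<close> is a function on \<open>nat\<close> of which only the values on \<open>{1..q}\<close>
  matter; elements of \<open>[\<^bold>c]\<close> are extensional, so that distinct functions are
  distinct tuples.\<close>

definition index_box :: "nat \<Rightarrow> (nat \<Rightarrow> nat) \<Rightarrow> (nat \<Rightarrow> nat) set" where
  "index_box q c = (\<Pi>\<^sub>E j \<in> {1..q}. {1..c j})"

datatype letter = Zeta "nat \<Rightarrow> nat" | Tau nat

definition Sig :: "nat \<Rightarrow> (nat \<Rightarrow> nat) \<Rightarrow> letter set" where
  "Sig q c = Zeta ` index_box q c \<union> Tau ` {1..q}"

lemma card_Sig: "card (Sig q c) = q + (\<Prod>j = 1..q. c j)"
proof -
  have fin: "finite (index_box q c)"
    unfolding index_box_def by (intro finite_PiE) auto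
  have "card (Sig q c) = card (Zeta ` index_box q c) + card (Tau ` {1..q})"
    unfolding Sig_def by (rule card_Un_disjoint) (use fin in auto)
  also have "\<dots> = card (index_box q c) + q"
    by (simp add: card_image inj_on_def)
  also have "card (index_box q c) = (\<Prod>j = 1..q. c j)"
    by (simp add: index_box_def card_PiE)
  finally show ?thesis by simp
qed

definition tau_sorted :: "letter list \<Rightarrow> bool" where
  "tau_sorted w \<longleftrightarrow> (\<forall>i j. sublist [Tau i, Tau j] w \<longrightarrow> i \<le> j)"

definition zeta_sorted :: "nat \<Rightarrow> letter list \<Rightarrow> bool" where
  "zeta_sorted j w \<longleftrightarrow>
     (\<forall>u. sublist u w \<and> Tau j \<notin> set u \<longrightarrow>
        (\<forall>a b i i'. a < b \<and> b < length u \<and> u ! a = Zeta i \<and> u ! b = Zeta i' \<longrightarrow> i j \<le> i' j))"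

definition Lang :: "nat \<Rightarrow> (nat \<Rightarrow> nat) \<Rightarrow> letter list set" where
  "Lang q c = {w \<in> lists (Sig q c). tau_sorted w \<and> (\<forall>j \<in> {1..q}. zeta_sorted j w)}"

end

theory Submission imports Defs begin

text \<open>
  The language is closed under deleting the last letter, and whether a word of it may be extended
  by a given letter depends only on a bounded amount of information about that word.  For
  condition (1) it suffices to know whether the word ends in some \<open>\<tau>\<^sub>i\<close>, and for which \<open>i\<close>.
  For condition (2) at \<open>j\<close>, a new \<open>\<zeta>\<close> is constrained exactly by the \<open>\<zeta>\<close>s that occur after the
  last \<open>\<tau>\<^sub>j\<close>; their \<open>j\<close>-th entries already increase weakly, so only the most recent one matters.
  If no such letter exists, \<open>0\<close> is recorded, which imposes no bound on the next letter.  The resulting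
  \<open>summary\<close> takes finitely many values on words over the alphabet, and the summary of an extended
  word is determined by the old summary and the new letter.

  Hence equality of summaries is a right congruence of finite index on the language, and, as in the
  Myhill--Nerode theorem, the summaries serve as the states of an automaton
  (\<open>recognized_if_finite_summary\<close>).  Prefix-closedness makes every state accepting: a word
  outside the language is rejected because some transition is undefined.
\<close>

section \<open>Recognition of prefix-closed languages\<close>

text \<open>
  Of the Myhill--Nerode theorem, this is the direction that constructs the automaton, for a
  prefix-closed language and a congruence given as the kernel of a map \<open>h\<close>.
\<close>

lemma recognized_if_finite_summary:
  fixes S :: "'a set" and L :: "'a list set" and h :: "'a list \<Rightarrow> 'p"
  assumes over: "L \<subseteq> lists S"
    and empty: "[] \<in> L"
    and closed: "\<And>w x. w @ [x] \<in> L \<Longrightarrow> w \<in> L"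
    and fin: "finite (h ` L)"
    and congruence: "\<And>v w x. v \<in> L \<Longrightarrow> w @ [x] \<in> L \<Longrightarrow> h v = h w \<Longrightarrow>
      v @ [x] \<in> L \<and> h (v @ [x]) = h (w @ [x])"
  shows "recognized_by_finite_automaton S L"
proof -
  obtain f :: "'p \<Rightarrow> nat" where inj: "inj_on f (h ` L)"
    using finite_imp_inj_to_nat_seg[OF fin] by blast
  define g where "g w = f (h w)" for w
  have g_cong: "v @ [x] \<in> L \<and> g (v @ [x]) = g (w @ [x])"
    if "v \<in> L" "w @ [x] \<in> L" "g v = g w" for v w x
  proof -
    have "h v = h w"
    proof (rule inj_onD[OF inj])
      show "f (h v) = f (h w)"
        using that by (simp add: g_def)
    qed (use that closed in blast)+
    then show ?thesis
      using congruence that by (simp add: g_def)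
  qed
  \<comment> \<open>A state knows only the summary of the word read so far.  A transition picks some word with that
    summary that can be extended inside the language; by congruence the choice is immaterial.\<close>
  define witness where "witness p x w \<longleftrightarrow> w @ [x] \<in> L \<and> g w = p" for p x w
  define A :: "(nat, 'a) automaton" where
    "A = \<lparr>states = g ` L, alphabet = S,
          trans = (\<lambda>(p, x). if \<exists>w. witness p x w then Some (g ((SOME w. witness p x w) @ [x]))
                            else None),
          init = g [], accepting = g ` L\<rparr>"
  have sel: "states A = g ` L" "alphabet A = S" "init A = g []" "accepting A = g ` L"
    by (simp_all add: A_def)
  have trans_SomeD: "\<exists>w. witness p x w \<and> r = g (w @ [x])" if "trans A (p, x) = Some r" for p x r
    using that someI_ex[of "witness p x"] by (auto simp: A_def split: if_splits)
  have trans_eq: "trans A (g w, x) = Some (g (w @ [x]))" if "w @ [x] \<in> L" for w x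
  proof -
    have ex: "\<exists>v. witness (g w) x v"
      using that by (auto simp: witness_def)
    then have "witness (g w) x (SOME v. witness (g w) x v)"
      by (rule someI_ex)
    then have "g ((SOME v. witness (g w) x v) @ [x]) = g (w @ [x])"
      using g_cong[of w _ x] closed[OF that] unfolding witness_def by metis
    then show ?thesis
      using ex by (simp add: A_def)
  qed
  have prefix_in: "take k w \<in> L" if "w \<in> L" for k w
    using that
  proof (induction w rule: rev_induct)
    case (snoc x w)
    then show ?case
      using closed[of w x] by (cases "k \<le> length w") auto
  qed (use empty in simp)
  have "finite_automaton A"
    unfolding finite_automaton_def
  proof (intro conjI subsetI)
    have "states A = f ` h ` L"
      by (auto simp: sel g_def)
    then show "finite (states A)"
      using fin by simp
  next
    show "z \<in> states A \<times> alphabet A" if z: "z \<in> dom (trans A)" for z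
    proof -
      obtain p x r where "z = (p, x)" "trans A (p, x) = Some r"
        using z by (cases z) auto
      then obtain w where "w @ [x] \<in> L" "g w = p"
        by (auto simp: witness_def dest!: trans_SomeD)
      then show ?thesis
        using closed[of w x] over \<open>z = (p, x)\<close> by (auto simp: sel)
    qed
  next
    show "r \<in> states A" if "r \<in> ran (trans A)" for r
      using that by (auto simp: sel ran_def witness_def dest!: trans_SomeD)
  qed (use empty in \<open>auto simp: sel\<close>)
  moreover have "w \<in> L" if acc: "accepts A w" for w
  proof -
    obtain r where start: "r 0 = g []"
      and step: "\<And>k. k < length w \<Longrightarrow> trans A (r k, w ! k) = Some (r (Suc k))"
      using acc by (auto simp: accepts_def sel)
    have "take k w \<in> L \<and> r k = g (take k w)" if "k \<le> length w" for k
      using that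
    proof (induction k)
      case 0
      then show ?case
        using empty start by simp
    next
      case (Suc k)
      then have IH: "take k w \<in> L" "r k = g (take k w)"
        by auto
      obtain v where "v @ [w ! k] \<in> L" "g v = r k" "r (Suc k) = g (v @ [w ! k])"
        using trans_SomeD[OF step[of k]] Suc.prems by (auto simp: witness_def)
      then show ?case
        using g_cong[of "take k w" v "w ! k"] IH Suc.prems by (simp add: take_Suc_conv_app_nth)
    qed
    from this[of "length w"] show ?thesis
      by simp
  qed
  moreover have "accepts A w" if "w \<in> L" for w
    unfolding accepts_def
  proof (intro exI[of _ "\<lambda>k. g (take k w)"] conjI allI impI)
    fix k
    assume "k < length w"
    then show "trans A (g (take k w), w ! k) = Some (g (take (Suc k) w))"
      using trans_eq[of "take k w" "w ! k"] prefix_in[OF that, of "Suc k"]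
      by (simp add: take_Suc_conv_app_nth)
  qed (use that prefix_in in \<open>auto simp: sel\<close>)
  ultimately show ?thesis
    using over unfolding recognized_by_finite_automaton_def recognizes_def
    by (intro exI[of _ A]) (auto simp: sel)
qed

section \<open>Adding a letter at the end\<close>

text \<open>The value \<open>0\<close> stands for words not ending in a \<open>\<tau>\<close>, because it imposes no constraint.\<close>

definition final_tau :: "letter list \<Rightarrow> nat" where
  "final_tau w = (if w = [] then 0 else case last w of Tau k \<Rightarrow> k | Zeta _ \<Rightarrow> 0)"

lemma final_tau_snoc: "final_tau (w @ [x]) = (case x of Tau k \<Rightarrow> k | Zeta _ \<Rightarrow> 0)"
  by (simp add: final_tau_def)

lemma tau_sorted_snoc:
  "tau_sorted (w @ [x]) \<longleftrightarrow> tau_sorted w \<and> (\<forall>k. x = Tau k \<longrightarrow> final_tau w \<le> k)"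
proof -
  have "suffix [Tau i, Tau j] (w @ [x]) \<longleftrightarrow> x = Tau j \<and> w \<noteq> [] \<and> last w = Tau i" for i j
    by (cases w rule: rev_cases) (auto simp: suffix_def)
  then have "tau_sorted (w @ [x]) \<longleftrightarrow>
      tau_sorted w \<and> (\<forall>i j. x = Tau j \<and> w \<noteq> [] \<and> last w = Tau i \<longrightarrow> i \<le> j)"
    unfolding tau_sorted_def sublist_snoc by blast
  then show ?thesis
    by (auto simp: final_tau_def split: letter.splits)
qed

text \<open>The \<open>\<zeta>\<close>s with which a further \<open>\<zeta>\<close> at the end shares a substring without \<open>\<tau>\<^sub>j\<close>.\<close>

definition live_zetas :: "nat \<Rightarrow> letter list \<Rightarrow> (nat \<Rightarrow> nat) set" where
  "live_zetas j w = {i. \<exists>u. suffix u w \<and> Tau j \<notin> set u \<and> Zeta i \<in> set u}"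

lemma live_zetas_Nil: "live_zetas j [] = {}"
  by (simp add: live_zetas_def)

lemma live_zetas_snoc:
  "live_zetas j (w @ [x]) =
     (case x of Zeta i \<Rightarrow> insert i (live_zetas j w)
              | Tau k \<Rightarrow> if k = j then {} else live_zetas j w)"
proof -
  have "i \<in> live_zetas j (w @ [x]) \<longleftrightarrow> x \<noteq> Tau j \<and> (x = Zeta i \<or> i \<in> live_zetas j w)" for i
  proof -
    have "i \<in> live_zetas j (w @ [x]) \<longleftrightarrow>
        (\<exists>u. suffix u w \<and> Tau j \<notin> set (u @ [x]) \<and> Zeta i \<in> set (u @ [x]))"
      unfolding live_zetas_def suffix_snoc by auto
    also have "\<dots> \<longleftrightarrow> x \<noteq> Tau j \<and> (x = Zeta i \<or> i \<in> live_zetas j w)"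
      unfolding live_zetas_def using Nil_suffix[of w] by fastforce
    finally show ?thesis .
  qed
  then show ?thesis
    by (auto split: letter.splits)
qed

text \<open>
  A substring of the longer word is either a substring of \<open>w\<close> or a suffix of \<open>w\<close> followed by \<open>x\<close>.
  In the second case the only new pairs of letters are those with \<open>x\<close> on the right, and their left
  members are the live \<open>\<zeta>\<close>s of \<open>w\<close>.
\<close>

lemma zeta_sorted_snoc:
  "zeta_sorted j (w @ [x]) \<longleftrightarrow>
     zeta_sorted j w \<and> (\<forall>i'. x = Zeta i' \<longrightarrow> (\<forall>i \<in> live_zetas j w. i j \<le> i' j))"
proof (intro iffI conjI allI impI ballI)
  assume "zeta_sorted j (w @ [x])"
  then show "zeta_sorted j w"
    unfolding zeta_sorted_def sublist_snoc by blast
next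
  fix i i'
  assume sorted: "zeta_sorted j (w @ [x])" and x: "x = Zeta i'" and "i \<in> live_zetas j w"
  then obtain u a where u: "suffix u w" "Tau j \<notin> set u" and a: "a < length u" "u ! a = Zeta i"
    by (auto simp: live_zetas_def in_set_conv_nth)
  have "sublist (u @ [x]) (w @ [x])"
    using u(1) by (simp add: sublist_snoc)
  moreover have "Tau j \<notin> set (u @ [x])"
    using u(2) x by simp
  moreover have "a < length u \<and> length u < length (u @ [x]) \<and>
      (u @ [x]) ! a = Zeta i \<and> (u @ [x]) ! length u = Zeta i'"
    using a x by (simp add: nth_append)
  ultimately show "i j \<le> i' j"
    using sorted unfolding zeta_sorted_def by blast
next
  assume R: "zeta_sorted j w \<and> (\<forall>i'. x = Zeta i' \<longrightarrow> (\<forall>i \<in> live_zetas j w. i j \<le> i' j))"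
  show "zeta_sorted j (w @ [x])"
    unfolding zeta_sorted_def
  proof (intro allI impI, elim conjE)
    fix u a b i i'
    assume u: "sublist u (w @ [x])" "Tau j \<notin> set u"
      and ab: "a < b" "b < length u" "u ! a = Zeta i" "u ! b = Zeta i'"
    have inside: "i j \<le> i' j" if "sublist v w" "Tau j \<notin> set v" "b < length v"
        "v ! a = Zeta i" "v ! b = Zeta i'" for v
      using R that \<open>a < b\<close> unfolding zeta_sorted_def by blast
    consider "sublist u w" | v where "suffix v w" "u = v @ [x]"
      using u(1) ab by (auto simp: sublist_snoc suffix_snoc)
    then show "i j \<le> i' j"
    proof cases
      case 1
      then show ?thesis
        using inside u ab by blast
    next
      case 2
      show ?thesis
      proof (cases "b < length v")
        case True
        then show ?thesis
          using inside[of v] 2 u ab by (auto simp: nth_append intro: suffix_imp_sublist)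
      next
        case False
        then have "b = length v" "x = Zeta i'"
          using 2 ab by (auto simp: nth_append)
        moreover from this have "Zeta i \<in> set v"
          using 2 ab by (auto simp: nth_append in_set_conv_nth)
        then have "i \<in> live_zetas j w"
          using 2 u by (auto simp: live_zetas_def)
        ultimately show ?thesis
          using R by blast
      qed
    qed
  qed
qed

section \<open>The finite summary of a word\<close>

fun update_entry :: "nat \<Rightarrow> nat \<Rightarrow> letter \<Rightarrow> nat" where
  "update_entry j e (Zeta i) = i j"
| "update_entry j e (Tau k) = (if k = j then 0 else e)"

definition last_entry :: "nat \<Rightarrow> letter list \<Rightarrow> nat" where
  "last_entry j w = foldl (update_entry j) 0 w"

lemma last_entry_snoc: "last_entry j (w @ [x]) = update_entry j (last_entry j w) x"
  by (simp add: last_entry_def)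

text \<open>
  In a sorted word the most recent live \<open>\<zeta>\<close> has the largest \<open>j\<close>-th entry, so it alone decides
  whether a new entry \<open>n\<close> is allowed; without live \<open>\<zeta>\<close>s both sides hold.
\<close>

lemma live_zetas_bounded_iff_last_entry:
  assumes "zeta_sorted j w"
  shows "(\<forall>i \<in> live_zetas j w. i j \<le> n) \<longleftrightarrow> last_entry j w \<le> n"
  using assms
proof (induction w arbitrary: n rule: rev_induct)
  case Nil
  then show ?case
    by (simp add: live_zetas_Nil last_entry_def)
next
  case (snoc x w)
  then show ?case
    by (cases x) (auto simp: zeta_sorted_snoc live_zetas_snoc last_entry_snoc)
qed

definition summary :: "nat \<Rightarrow> letter list \<Rightarrow> nat \<times> (nat \<Rightarrow> nat)" where
  "summary q w = (final_tau w, \<lambda>j \<in> {1..q}. last_entry j w)"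

lemma summary_eq_iff:
  "summary q v = summary q w \<longleftrightarrow>
     final_tau v = final_tau w \<and> (\<forall>j \<in> {1..q}. last_entry j v = last_entry j w)"
  by (auto simp: summary_def fun_eq_iff restrict_def)

lemma summary_snoc_cong:
  "summary q v = summary q w \<Longrightarrow> summary q (v @ [x]) = summary q (w @ [x])"
  by (cases x) (auto simp: summary_eq_iff final_tau_snoc last_entry_snoc)

lemma finite_summaries: "finite (summary q ` lists (Sig q c))"
proof (rule finite_subset)
  have final: "final_tau w \<le> q" if "w \<in> lists (Sig q c)" for w
    using that by (cases w rule: rev_cases) (auto simp: final_tau_def Sig_def)
  have entry: "last_entry j w \<le> c j" if "w \<in> lists (Sig q c)" "j \<in> {1..q}" for j w
    using that
  proof (induction w rule: rev_induct)
    case Nil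
    then show ?case
      by (simp add: last_entry_def)
  next
    case (snoc x w)
    then show ?case
      by (auto simp: last_entry_snoc Sig_def index_box_def)
  qed
  show "summary q ` lists (Sig q c) \<subseteq> {..q} \<times> (\<Pi>\<^sub>E j \<in> {1..q}. {..c j})"
  proof (rule image_subsetI)
    fix w
    assume "w \<in> lists (Sig q c)"
    then show "summary q w \<in> {..q} \<times> (\<Pi>\<^sub>E j \<in> {1..q}. {..c j})"
      using final[of w] entry[of w] by (simp add: summary_def del: in_lists_conv_set)
  qed
  show "finite ({..q} \<times> (\<Pi>\<^sub>E j \<in> {1..q}. {..c j}))"
    by (intro finite_cartesian_product finite_PiE) auto
qed

section \<open>Recognition of the language\<close>

lemma Nil_in_Lang: "[] \<in> Lang q c"
  by (auto simp: Lang_def tau_sorted_def zeta_sorted_def)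

lemma snoc_in_Lang_iff:
  "w @ [x] \<in> Lang q c \<longleftrightarrow>
     w \<in> Lang q c \<and> x \<in> Sig q c \<and>
     (\<forall>k. x = Tau k \<longrightarrow> final_tau w \<le> k) \<and>
     (\<forall>i. x = Zeta i \<longrightarrow> (\<forall>j \<in> {1..q}. last_entry j w \<le> i j))"
proof -
  have "zeta_sorted j (w @ [x]) \<longleftrightarrow>
      zeta_sorted j w \<and> (\<forall>i. x = Zeta i \<longrightarrow> last_entry j w \<le> i j)" for j
    using live_zetas_bounded_iff_last_entry[of j w] by (auto simp: zeta_sorted_snoc)
  then show ?thesis
    by (auto simp: Lang_def tau_sorted_snoc)
qed

theorem proposition4p7:
  fixes q :: nat and c :: "nat \<Rightarrow> nat"
  assumes "q \<ge> 1" and "\<And>j. j \<in> {1..q} \<Longrightarrow> c j \<ge> 1"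
  shows "recognized_by_finite_automaton (Sig q c) (Lang q c)"
proof (rule recognized_if_finite_summary)
  show "Lang q c \<subseteq> lists (Sig q c)"
    by (auto simp: Lang_def)
  then show "finite (summary q ` Lang q c)"
    using finite_summaries finite_subset image_mono by metis
  show "[] \<in> Lang q c"
    by (rule Nil_in_Lang)
  show "w \<in> Lang q c" if "w @ [x] \<in> Lang q c" for w x
    using that by (simp add: snoc_in_Lang_iff)
  show "v @ [x] \<in> Lang q c \<and> summary q (v @ [x]) = summary q (w @ [x])"
    if "v \<in> Lang q c" "w @ [x] \<in> Lang q c" "summary q v = summary q w" for v w x
    using that summary_snoc_cong[of q v w x] by (simp add: snoc_in_Lang_iff summary_eq_iff)
qed

end
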